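(* Let $A\in\mathbb{R}^{d\times d}$ and $f:\mathbb{R}^d\to\mathbb{R}^d$ be such that the DAE $A\dot z=f(z)$ is regular with configuration space $\mathcal{M}$. Let $z^{(0)}\in\mathcal{M}$ be the initial condition and let $z^{(m)}$ ($m=1,2,\dots$) be the solution of the implicit Euler method $$A\frac{z^{(m+1)}-z^{(m)}}{\Delta t}=f\big(z^{(m+1)}\big),\qquad m=0,1,\dots,$$ with step size $\Delta t>0$. Suppose that $V(z)=\langle\gamma,z\rangle$ (with $\gamma\in\mathbb{R}^d$ a constant vector) is a conserved quantity of the DAE satisfying $\gamma\in\mathrm{car}(A)$, and that the DAE has uniform index $1$. Then $V(z^{(m+1)})=V(z^{(m)})$ holds for every $m=0,1,\dots$.
   Context: The DAE $A\dot z=f(z)$, with $A$ possibly singular, is called regular if there are a differentiable submanifold $\mathcal{M}$ of $\mathbb{R}^d$ (the configuration space) and a vector field $v:\mathcal{M}\to T\mathcal{M}$ such that a differentiable map $w:[0,T)\to\mathcal{M}$ is a solution of $\dot w=v(w)$ if and only if $z=j\circ w$ is a solution of the DAE, where $j:\mathcal{M}\to\mathbb{R}^d$ is the inclusion. $\mathcal{M}$ is the maximal manifold such that for every $z\in\mathcal{M}$ the set $T_z\mathcal{M}\cap\{w\in\mathbb{R}^d\mid Aw=f(z)\}$ is a singleton. Let $\ell=d-\mathrm{rank}\,A$ and let $B=(b_1,\dots,b_\ell)$ have as columns an orthonormal basis of $(\mathrm{range}\,A)^\perp$; the DAE has uniform index $1$ if and only if $\mathcal{M}=\{z\in\mathbb{R}^d\mid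 B^\top f(z)=0\}$. $\mathrm{car}(A)=\mathrm{null}(A)^\perp$. $V$ is a conserved quantity of the DAE if $\frac{d}{dt}V(z(t))=0$ for every solution $z$ of the DAE. *)

theory Defs
  imports "HOL-Analysis.Analysis"
begin

section \<open>Differentiable submanifolds of Euclidean space\<close>

definition C1_on :: "'a::euclidean_space set \<Rightarrow> ('a \<Rightarrow> 'b::euclidean_space) \<Rightarrow> bool" where
  "C1_on U g \<longleftrightarrow>
     (\<exists>g' :: 'a \<Rightarrow> 'a \<Rightarrow>\<^sub>L 'b. continuous_on U g' \<and>
        (\<forall>x\<in>U. (g has_derivative blinfun_apply (g' x)) (at x)))"

text \<open>Embedded $C^1$ submanifolds of dimension $k$: near each of its points the set is
  straightened by a $C^1$ diffeomorphism of open subsets of the ambient space to (an open piece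
  of) a $k$-dimensional linear subspace.\<close>

definition C1_submanifold :: "nat \<Rightarrow> 'a::euclidean_space set \<Rightarrow> bool" where
  "C1_submanifold k M \<longleftrightarrow>
     (\<forall>p\<in>M. \<exists>U W S. \<exists>\<phi> \<psi> :: 'a \<Rightarrow> 'a. open U \<and> p \<in> U \<and> open W \<and>
        homeomorphism U W \<phi> \<psi> \<and>
        C1_on U \<phi> \<and> C1_on W \<psi> \<and> subspace S \<and> dim S = k \<and> \<phi> ` (U \<inter> M) = W \<inter> S)"

text \<open>Tangent vectors are the velocities of differentiable curves lying in \<open>M\<close>.\<close>

definition tangent_space :: "'a::euclidean_space set \<Rightarrow> 'a \<Rightarrow> 'a set" where
  "tangent_space M p =
     {u. \<exists>\<epsilon>>0. \<exists>c :: real \<Rightarrow> 'a. c differentiable_on {-\<epsilon><..<\<epsilon>} \<and> c ` {-\<epsilon><..<\<epsilon>} \<subseteq> M \<and>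
           c 0 = p \<and> (c has_vector_derivative u) (at 0)}"


section \<open>Differential-algebraic equations\<close>

text \<open>Solutions live on \<open>[0, T)\<close>; the derivative at \<open>0\<close> is one-sided.\<close>

definition ode_solution :: "('a::real_normed_vector \<Rightarrow> 'a) \<Rightarrow> real \<Rightarrow> (real \<Rightarrow> 'a) \<Rightarrow> bool" where
  "ode_solution v T w \<longleftrightarrow>
     (\<forall>t\<in>{0..<T}. (w has_vector_derivative v (w t)) (at t within {0..<T}))"

definition dae_solution ::
    "real ^ 'd ^ 'd \<Rightarrow> (real ^ 'd \<Rightarrow> real ^ 'd) \<Rightarrow> real \<Rightarrow> (real \<Rightarrow> real ^ 'd) \<Rightarrow> bool" where
  "dae_solution A f T z \<longleftrightarrow>
     (\<forall>t\<in>{0..<T}. \<exists>z'. (z has_vector_derivative z') (at t within {0..<T}) \<and> A *v z' = f (z t))"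

definition unique_tangent_velocity ::
    "real ^ 'd ^ 'd \<Rightarrow> (real ^ 'd \<Rightarrow> real ^ 'd) \<Rightarrow> (real ^ 'd) set \<Rightarrow> bool" where
  "unique_tangent_velocity A f M \<longleftrightarrow>
     (\<forall>z\<in>M. is_singleton (tangent_space M z \<inter> {u. A *v u = f z}))"

text \<open>The vector field is required to be continuous. This is the most that makes sense
  intrinsically on a $C^1$ manifold, and without it the ODE on \<open>M\<close> might have no solutions at all,
  which would make regularity vacuous. Maximality is with respect to inclusion, among submanifolds
  of any dimension.\<close>

definition regular_dae ::
    "real ^ 'd ^ 'd \<Rightarrow> (real ^ 'd \<Rightarrow> real ^ 'd) \<Rightarrow> (real ^ 'd) set \<Rightarrow> bool" where
  "regular_dae A f M \<longleftrightarrow>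
     (\<exists>k. C1_submanifold k M) \<and>
     (\<exists>v. continuous_on M v \<and> (\<forall>z\<in>M. v z \<in> tangent_space M z) \<and>
        (\<forall>T>0. \<forall>w. w differentiable_on {0..<T} \<and> w ` {0..<T} \<subseteq> M \<longrightarrow>
           (ode_solution v T w \<longleftrightarrow> dae_solution A f T w))) \<and>
     unique_tangent_velocity A f M \<and>
     (\<forall>N k. C1_submanifold k N \<and> unique_tangent_velocity A f N \<and> M \<subseteq> N \<longrightarrow> N = M)"

text \<open>The columns of $B$ are given as a family \<open>b\<close> indexed by \<open>i < l\<close> rather than as a typed
  matrix, because $\ell = d - \mathrm{rank}\,A$ may be zero.
  The set $\{z \mid B^\top f(z) = 0\}$ does not depend on the choice of the orthonormal basis.\<close>

definition orthonormal_basis ::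
    "nat \<Rightarrow> (nat \<Rightarrow> 'a::euclidean_space) \<Rightarrow> 'a set \<Rightarrow> bool" where
  "orthonormal_basis l b W \<longleftrightarrow>
     (\<forall>i<l. \<forall>j<l. b i \<bullet> b j = (if i = j then 1 else 0)) \<and> span (b ` {..<l}) = W"

definition uniform_index_1 ::
    "real ^ 'd ^ 'd \<Rightarrow> (real ^ 'd \<Rightarrow> real ^ 'd) \<Rightarrow> (real ^ 'd) set \<Rightarrow> bool" where
  "uniform_index_1 A f M \<longleftrightarrow>
     (\<exists>b. orthonormal_basis (CARD('d) - rank A) b (orthogonal_comp (range ((*v) A))) \<and>
        M = {z. \<forall>i < CARD('d) - rank A. b i \<bullet> f z = 0})"

definition car :: "real ^ 'd ^ 'd \<Rightarrow> (real ^ 'd) set" where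
  "car A = orthogonal_comp {x. A *v x = 0}"

definition conserved_quantity ::
    "real ^ 'd ^ 'd \<Rightarrow> (real ^ 'd \<Rightarrow> real ^ 'd) \<Rightarrow> (real ^ 'd \<Rightarrow> real) \<Rightarrow> bool" where
  "conserved_quantity A f V \<longleftrightarrow>
     (\<forall>T>0. \<forall>z. dae_solution A f T z \<longrightarrow>
        (\<forall>t\<in>{0..<T}. ((\<lambda>s. V (z s)) has_real_derivative 0) (at t within {0..<T})))"

definition implicit_euler ::
    "real ^ 'd ^ 'd \<Rightarrow> (real ^ 'd \<Rightarrow> real ^ 'd) \<Rightarrow> real \<Rightarrow> (nat \<Rightarrow> real ^ 'd) \<Rightarrow> bool" where
  "implicit_euler A f dt z \<longleftrightarrow>
     (\<forall>m. A *v ((z (Suc m) - z m) /\<^sub>R dt) = f (z (Suc m)))"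

end

theory Submission
  imports Defs "HOL-Complex_Analysis.Great_Picard"
begin

text \<open>Write \<open>\<gamma> = A\<^sup>T \<eta>\<close>, so that \<open>V\<close> changes by \<open>dt * (\<eta> \<bullet> f (z (Suc m)))\<close> in one Euler step. Uniform
  index 1 forces every iterate after a step to lie in \<open>M\<close>, so it suffices that \<open>\<eta> \<bullet> f\<close> vanishes
  on \<open>M\<close>. For a solution of the DAE starting at \<open>p \<in> M\<close>, the derivative of \<open>V\<close> at time \<open>0\<close> is \<open>\<eta> \<bullet> f p\<close>,
  and conservation makes it vanish. Such a solution exists because the continuous vector field
  on \<open>M\<close> has integral curves by Peano's theorem, which is proved with Tonelli's delayed
  approximations and the Arzela-Ascoli theorem.\<close>

section \<open>Peano's existence theorem for a bounded continuous field on the whole space\<close>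

lemma integral_lipschitz:
  fixes f :: "real \<Rightarrow> 'a::banach"
  assumes f: "continuous_on UNIV f" and B: "\<And>x. norm (f x) \<le> B"
  shows "norm (integral {0..t} f - integral {0..s} f) \<le> B * \<bar>t - s\<bar>"
proof (induction s t rule: linorder_wlog)
  case (le s t)
  have B0: "0 \<le> B" using B[of 0] norm_ge_zero order_trans by blast
  have cf: "continuous_on {a..b} f" for a b
    using f continuous_on_subset by blast
  consider "t < 0" | "s < 0" "0 \<le> t" | "0 \<le> s" by linarith
  then show ?case
  proof cases
    case 1
    then show ?thesis using B0 le by simp
  next
    case 2
    then have "norm (integral {0..t} f) \<le> B * (t - 0)"
      using B cf by (intro integral_bound) auto
    also have "\<dots> \<le> B * (t - s)"
      using 2 B0 by (intro mult_left_mono) auto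
    finally show ?thesis using 2 by simp
  next
    case 3
    have "integral {0..s} f + integral {s..t} f = integral {0..t} f"
      using 3 le cf by (intro Henstock_Kurzweil_Integration.integral_combine integrable_continuous_real) auto
    then have "integral {0..t} f - integral {0..s} f = integral {s..t} f"
      by (simp add: algebra_simps)
    then show ?thesis
      using integral_bound[OF le cf, of B] B le by simp
  qed
next
  case (sym s t)
  then show ?case by (simp add: norm_minus_commute abs_minus_commute)
qed

text \<open>The iterates of the delayed integral operator become stationary on \<open>{..k * h}\<close> after
  \<open>k\<close> steps.\<close>

lemma delayed_integral_equation:
  fixes G :: "'a::banach \<Rightarrow> 'a" and h :: real
  assumes G: "continuous_on UNIV G" and B: "\<And>x. norm (G x) \<le> B" and "0 < h"
  obtains y :: "real \<Rightarrow> 'a" where "continuous_on UNIV y"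
    and "\<And>t. t \<le> 1 \<Longrightarrow> y t = y0 + integral {0..t} (\<lambda>s. G (y (s - h)))"
proof -
  define D where "D = (\<lambda>x t. y0 + integral {0..t} (\<lambda>s. G (x (s - h))))"
  define X where "X = (\<lambda>k. (D ^^ k) (\<lambda>_. y0))"
  have X_Suc: "X (Suc k) = D (X k)" for k by (simp add: X_def)
  have comp: "continuous_on UNIV (\<lambda>s. G (x (s - h)))" if "continuous_on UNIV x" for x
    by (intro continuous_on_compose2[OF G] continuous_on_compose2[OF that] continuous_intros) auto
  have D_cont: "continuous_on UNIV (D x)" if "continuous_on UNIV x" for x
  proof (rule lipschitz_on_continuous_on)
    show "B-lipschitz_on UNIV (D x)"
    proof (rule lipschitz_onI)
      show "dist (D x s) (D x t) \<le> B * dist s t" for s t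
        using integral_lipschitz[OF comp[OF that], of B s t] B
        by (simp add: D_def dist_norm)
      show "0 \<le> B" using B[of 0] norm_ge_zero order_trans by blast
    qed
  qed
  have X_cont: "continuous_on UNIV (X k)" for k
    by (induction k) (auto simp: X_Suc D_cont, simp add: X_def)
  have stat: "X (Suc k) t = X k t" if "t \<le> real k * h" for k t
    using that
  proof (induction k arbitrary: t)
    case 0
    \<comment> \<open>For \<open>t\<close> at most 0 the integral is over an empty or one-point
      interval, so both iterates equal \<open>y0\<close>.\<close>
    then have "t < 0 \<or> t = 0" by auto
    then show ?case by (auto simp: X_def D_def)
  next
    case (Suc k)
    \<comment> \<open>If \<open>s\<close> is at most \<open>(k + 1) * h\<close>, then
      \<open>s - h\<close> is at most \<open>k * h\<close>, where the induction hypothesis applies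
      under the integral.\<close>
    have "integral {0..t} (\<lambda>s. G (X (Suc k) (s - h))) = integral {0..t} (\<lambda>s. G (X k (s - h)))"
      using Suc by (intro Henstock_Kurzweil_Integration.integral_cong) (auto simp: algebra_simps)
    then show ?case by (simp add: X_Suc[of "Suc k"] X_Suc[of k] D_def)
  qed
  \<comment> \<open>Once \<open>k * h\<close> reaches 1, the iterate \<open>X k\<close> is a fixed
    point of \<open>D\<close> on all \<open>t\<close> up to 1.\<close>
  obtain k where "1 / h < real k" using reals_Archimedean2 by blast
  then have "1 \<le> real k * h" using \<open>0 < h\<close> by (simp add: field_simps)
  then have "X k t = y0 + integral {0..t} (\<lambda>s. G (X k (s - h)))" if "t \<le> 1" for t
    using stat[of t k] that by (simp add: X_Suc D_def)
  with X_cont show thesis using that by blast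
qed

text \<open>The solutions with delay \<open>h n\<close> share the Lipschitz constant
  \<open>B\<close> and the initial value \<open>y0\<close>, so a subsequence converges uniformly on
  \<open>{0..1}\<close>. The delay tends to 0, and dominated convergence passes the integral
  equation to the limit.\<close>

theorem Peano_integral_equation:
  fixes G :: "'a::euclidean_space \<Rightarrow> 'a"
  assumes G: "continuous_on UNIV G" and B: "\<And>x. norm (G x) \<le> B"
  shows "\<exists>y :: real \<Rightarrow> 'a. continuous_on {0..1} y \<and>
    (\<forall>t\<in>{0..1}. y t = y0 + integral {0..t} (\<lambda>s. G (y s)))"
proof -
  define h where "h = (\<lambda>n. inverse (real (Suc n)))"
  have h: "0 < h n" for n by (simp add: h_def)
  have h0: "h \<longlonglongrightarrow> 0" unfolding h_def by (rule LIMSEQ_inverse_real_of_nat)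
  have B0: "0 \<le> B" using B[of 0] norm_ge_zero order_trans by blast
  have "\<exists>y. continuous_on UNIV y \<and> (\<forall>t\<le>1. y t = y0 + integral {0..t} (\<lambda>s. G (y (s - h n))))" for n
    using delayed_integral_equation[OF G B h] by metis
  then obtain Y where Yc: "\<And>n. continuous_on UNIV (Y n)"
    and Y: "\<And>n t. t \<le> 1 \<Longrightarrow> Y n t = y0 + integral {0..t} (\<lambda>s. G (Y n (s - h n)))"
    by metis
  have comp: "continuous_on UNIV (\<lambda>s. G (Y n (s - h n)))" for n
    by (intro continuous_on_compose2[OF G] continuous_on_compose2[OF Yc] continuous_intros) auto
  \<comment> \<open>Negative times are included, since \<open>t - h n\<close> can be
    negative.\<close>
  have lip: "norm (Y n t - Y n s) \<le> B * \<bar>t - s\<bar>" if "t \<le> 1" "s \<le> 1" for n s t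
    using integral_lipschitz[OF comp[of n] B, of t s] that by (simp add: Y)
  have Y_0: "Y n 0 = y0" for n by (simp add: Y)
  obtain y k where y: "continuous_on {0..1} y" and k: "strict_mono (k :: nat \<Rightarrow> nat)"
    and lim: "\<And>e. 0 < e \<Longrightarrow> \<exists>N. \<forall>n x. n \<ge> N \<and> x \<in> {0..1} \<longrightarrow> norm (Y (k n) x - y x) < e"
  proof (rule Arzela_Ascoli)
    show "compact {0..1::real}" by simp
    show "norm (Y n t) \<le> norm y0 + B" if "t \<in> {0..1}" for n t
    proof -
      have "norm (Y n t - y0) \<le> B * t" using lip[of t 0 n] that by (simp add: Y_0)
      also have "\<dots> \<le> B" using that B0 by (simp add: mult_left_le)
      finally show ?thesis using norm_triangle_sub[of "Y n t" y0] by linarith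
    qed
    show "\<exists>d>0. \<forall>n t. t \<in> {0..1} \<and> norm (s - t) < d \<longrightarrow> norm (Y n s - Y n t) < e"
      if "s \<in> {0..1}" "0 < e" for s e
    proof (intro exI conjI allI impI)
      \<comment> \<open>\<open>B\<close> may be 0, so the modulus of equicontinuity divides by
        \<open>B + 1\<close>.\<close>
      show "0 < e / (B + 1)" using that B0 by simp
      fix n t assume t: "t \<in> {0..1} \<and> norm (s - t) < e / (B + 1)"
      have "norm (Y n s - Y n t) \<le> B * \<bar>s - t\<bar>" using lip t that by auto
      also have "\<dots> \<le> (B + 1) * \<bar>s - t\<bar>" by (intro mult_right_mono) auto
      also have "\<dots> < e" using t B0 by (simp add: field_simps)
      finally show "norm (Y n s - Y n t) < e" .
    qed
  qed blast
  have Y_lim: "(\<lambda>n. Y (k n) t) \<longlonglongrightarrow> y t" if "t \<in> {0..1}" for t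
    using lim that unfolding LIMSEQ_iff by metis
  have hk: "(\<lambda>n. h (k n)) \<longlonglongrightarrow> 0"
    using LIMSEQ_subseq_LIMSEQ[OF h0 k] by (simp add: o_def)
  have Y_delay: "(\<lambda>n. Y (k n) (t - h (k n))) \<longlonglongrightarrow> y t" if t: "t \<in> {0..1}" for t
  proof -
    \<comment> \<open>By the common Lipschitz constant, the delay shifts the value by at most
      \<open>B * h (k n)\<close>.\<close>
    have "(\<lambda>n. Y (k n) (t - h (k n)) - Y (k n) t) \<longlonglongrightarrow> 0"
    proof (rule Lim_null_comparison)
      show "\<forall>\<^sub>F n in sequentially. norm (Y (k n) (t - h (k n)) - Y (k n) t) \<le> B * h (k n)"
      proof (rule always_eventually, rule allI)
        fix n
        show "norm (Y (k n) (t - h (k n)) - Y (k n) t) \<le> B * h (k n)"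
          using lip[of "t - h (k n)" t "k n"] t h[of "k n"] by simp
      qed
      show "(\<lambda>n. B * h (k n)) \<longlonglongrightarrow> 0" using tendsto_mult_right_zero[OF hk] .
    qed
    from tendsto_add[OF this Y_lim[OF t]] show ?thesis by simp
  qed
  have "y t = y0 + integral {0..t} (\<lambda>s. G (y s))" if t: "t \<in> {0..1}" for t
  proof -
    have "(\<lambda>n. integral {0..t} (\<lambda>s. G (Y (k n) (s - h (k n))))) \<longlonglongrightarrow> integral {0..t} (\<lambda>s. G (y s))"
    proof (rule dominated_convergence(2)[where h = "\<lambda>_. B"])
      show "(\<lambda>s. G (Y (k n) (s - h (k n)))) integrable_on {0..t}" for n
        using comp continuous_on_subset by (intro integrable_continuous_real) blast
      show "(\<lambda>n. G (Y (k n) (s - h (k n)))) \<longlonglongrightarrow> G (y s)" if "s \<in> {0..t}" for s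
        using continuous_on_tendsto_compose[OF G Y_delay] that t by simp
    qed (auto simp: B)
    from tendsto_add[OF tendsto_const this, of y0]
    have "(\<lambda>n. Y (k n) t) \<longlonglongrightarrow> y0 + integral {0..t} (\<lambda>s. G (y s))"
      using t by (simp add: Y)
    then show ?thesis using LIMSEQ_unique Y_lim[OF t] by blast
  qed
  with y show ?thesis by blast
qed

section \<open>Integral curves in subspaces and on submanifolds\<close>

text \<open>By Dugundji's theorem the vector field extends to the whole space, keeping its values
  in a ball of \<open>S\<close>; so solutions of the extended equation stay in \<open>S\<close>.\<close>

theorem Peano_subspace:
  fixes F :: "'a::euclidean_space \<Rightarrow> 'a"
  assumes "open W" "subspace S" "y0 \<in> W \<inter> S" and F: "continuous_on (W \<inter> S) F"
    and FS: "F ` (W \<inter> S) \<subseteq> S"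
  obtains T y where "0 < T" "y 0 = y0" "y ` {0..T} \<subseteq> W \<inter> S"
    "\<And>t. t \<in> {0..T} \<Longrightarrow> (y has_vector_derivative F (y t)) (at t within {0..T})"
proof -
  obtain r where r: "0 < r" "cball y0 r \<subseteq> W"
    using assms open_contains_cball by blast
  define K where "K = cball y0 r \<inter> S"
  have KW: "K \<subseteq> W \<inter> S" using r by (auto simp: K_def)
  have "compact K"
    unfolding K_def using closed_subspace[OF \<open>subspace S\<close>] by (simp add: compact_Int_closed)
  have FK: "continuous_on K F" using F KW continuous_on_subset by blast
  then have "bounded (F ` K)"
    using \<open>compact K\<close> compact_continuous_image compact_imp_bounded by blast
  then obtain B where B: "0 < B" "\<And>x. x \<in> K \<Longrightarrow> norm (F x) \<le> B"
    unfolding bounded_pos by blast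
  obtain G where G: "continuous_on UNIV G" "G ` UNIV \<subseteq> S \<inter> cball 0 B"
    and GF: "\<And>x. x \<in> K \<Longrightarrow> G x = F x"
  proof (rule Dugundji[of "S \<inter> cball 0 B" UNIV K F])
    show "convex (S \<inter> cball 0 B)"
      using \<open>subspace S\<close> by (intro convex_Int subspace_imp_convex convex_cball)
    show "S \<inter> cball 0 B \<noteq> {}" using subspace_0[OF \<open>subspace S\<close>] B by auto
    show "closedin (top_of_set UNIV) K"
      using compact_imp_closed[OF \<open>compact K\<close>] by simp
    show "F ` K \<subseteq> S \<inter> cball 0 B" using KW FS B by fastforce
  qed (use FK in blast)+
  have GB: "norm (G x) \<le> B" and GS: "G x \<in> S" for x using G(2) by (auto simp: image_subset_iff)
  obtain y :: "real \<Rightarrow> 'a" where y: "continuous_on {0..1} y"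
    and y_eq: "\<And>t. t \<in> {0..1} \<Longrightarrow> y t = y0 + integral {0..t} (\<lambda>s. G (y s))"
    using Peano_integral_equation[OF G(1) GB] by blast
  have Gy: "continuous_on {0..1} (\<lambda>s. G (y s))"
    by (intro continuous_on_compose2[OF G(1) y]) auto
  \<comment> \<open>At speed at most \<open>B\<close> the solution cannot leave the ball of radius
    \<open>r\<close> before time \<open>r / B\<close>; the integral equation is available up to time
    1.\<close>
  define T where "T = min 1 (r / B)"
  have T: "0 < T" "T \<le> 1" "B * T \<le> r" using r B by (auto simp: T_def min_def field_simps)
  have yK: "y t \<in> K" if t: "t \<in> {0..T}" for t
  proof -
    have c: "continuous_on {0..t} (\<lambda>s. G (y s))"
      using Gy by (rule continuous_on_subset) (use t T in auto)
    have eq: "y t - y0 = integral {0..t} (\<lambda>s. G (y s))" using y_eq t T by simp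
    have "norm (y t - y0) \<le> B * (t - 0)"
      unfolding eq using t GB c by (intro integral_bound) auto
    also have "\<dots> \<le> B * T" using t B by auto
    finally have 1: "y t \<in> cball y0 r" using T by (simp add: dist_norm norm_minus_commute)
    \<comment> \<open>The integral of an \<open>S\<close>-valued function lies in \<open>S\<close>:
      every \<open>u\<close> orthogonal to \<open>S\<close> can be moved under the integral, where
      it annihilates the integrand.\<close>
    have "y t - y0 \<in> S\<^sup>\<bottom>\<^sup>\<bottom>"
      unfolding orthogonal_comp_def[of "S\<^sup>\<bottom>"] orthogonal_def mem_Collect_eq
    proof
      fix u assume u: "u \<in> S\<^sup>\<bottom>"
      have "u \<bullet> integral {0..t} (\<lambda>s. G (y s)) = integral {0..t} ((\<bullet>) u \<circ> (\<lambda>s. G (y s)))"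
        by (rule integral_linear[symmetric])
          (use c in \<open>auto intro: integrable_continuous_real bounded_linear_inner_right\<close>)
      also have "(\<bullet>) u \<circ> (\<lambda>s. G (y s)) = (\<lambda>_. 0)"
        using u GS by (auto simp: orthogonal_comp_def orthogonal_def inner_commute[of u])
      finally show "u \<bullet> (y t - y0) = 0" by (simp add: eq)
    qed
    then have "y t - y0 \<in> S" using orthogonal_comp_self[OF \<open>subspace S\<close>] by simp
    then have "y0 + (y t - y0) \<in> S"
      using assms(2,3) subspace_add by blast
    then show ?thesis using 1 by (simp add: K_def)
  qed
  show thesis
  proof
    show "0 < T" by fact
    show "y 0 = y0" using y_eq[of 0] by simp
    show "y ` {0..T} \<subseteq> W \<inter> S" using yK KW by blast
    fix t assume t: "t \<in> {0..T}"
    have "((\<lambda>u. integral {0..u} (\<lambda>s. G (y s))) has_vector_derivative G (y t)) (at t within {0..1})"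
      using t T by (intro integral_has_vector_derivative[OF Gy]) auto
    then have "((\<lambda>u. y0 + integral {0..u} (\<lambda>s. G (y s))) has_vector_derivative F (y t)) (at t within {0..T})"
      using GF[OF yK[OF t]] T
      by (auto intro!: derivative_eq_intros elim: has_vector_derivative_within_subset)
    then show "(y has_vector_derivative F (y t)) (at t within {0..T})"
      by (rule has_vector_derivative_transform[OF t, rotated]) (use y_eq T in auto)
  qed
qed

text \<open>A vector \<open>u\<close> orthogonal to \<open>S\<close> gives a function
  \<open>u \<bullet> g t\<close> that vanishes near \<open>x\<close>, so \<open>u\<close> is
  orthogonal to the derivative as well; and \<open>S\<close> is its own double orthogonal
  complement.\<close>

lemma vector_derivative_in_subspace:
  fixes g :: "real \<Rightarrow> 'a::euclidean_space"
  assumes "subspace S" and g: "(g has_vector_derivative d) (at x)"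
    and X: "open X" "x \<in> X" "g ` X \<subseteq> S"
  shows "d \<in> S"
proof -
  have "u \<bullet> d = 0" if u: "u \<in> S\<^sup>\<bottom>" for u
  proof -
    have "((\<lambda>t. u \<bullet> g t) has_vector_derivative u \<bullet> d) (at x)"
      using bounded_linear.has_vector_derivative[OF bounded_linear_inner_right g] .
    moreover have "((\<lambda>t. u \<bullet> g t) has_vector_derivative 0) (at x)"
    proof (rule has_vector_derivative_transform_within_open[OF _ X(1,2)])
      show "((\<lambda>_. 0) has_vector_derivative 0) (at x)" by simp
      show "0 = u \<bullet> g t" if "t \<in> X" for t
        using that u X(3) by (auto simp: orthogonal_comp_def orthogonal_def inner_commute[of u])
    qed
    ultimately show ?thesis using vector_derivative_unique_at by blast
  qed
  then have "d \<in> S\<^sup>\<bottom>\<^sup>\<bottom>"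
    by (simp add: orthogonal_comp_def[of "S\<^sup>\<bottom>"] orthogonal_def)
  then show ?thesis using orthogonal_comp_self[OF \<open>subspace S\<close>] by simp
qed

text \<open>A straightening chart carries \<open>v\<close> to a continuous field on a relatively
  open piece of a subspace. The integral curve found there is mapped back by the inverse
  chart.\<close>

theorem Peano_submanifold:
  fixes M :: "'a::euclidean_space set"
  assumes "C1_submanifold k M" "p \<in> M" and v: "continuous_on M v"
    and tan: "\<And>z. z \<in> M \<Longrightarrow> v z \<in> tangent_space M z"
  obtains T w where "0 < T" "w 0 = p" "w ` {0..<T} \<subseteq> M" "ode_solution v T w"
proof -
  obtain U W S and \<phi> \<psi> :: "'a \<Rightarrow> 'a" where U: "open U" "p \<in> U" and W: "open W"
    and hom: "homeomorphism U W \<phi> \<psi>" and "C1_on U \<phi>" "C1_on W \<psi>" and S: "subspace S"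
    and img: "\<phi> ` (U \<inter> M) = W \<inter> S"
    using assms(1)[unfolded C1_submanifold_def, THEN bspec, OF assms(2)]
    by (elim exE conjE) (rule that)
  obtain \<phi>' where \<phi>'_cont: "continuous_on U \<phi>'"
    and \<phi>': "\<And>x. x \<in> U \<Longrightarrow> (\<phi> has_derivative blinfun_apply (\<phi>' x)) (at x)"
    using \<open>C1_on U \<phi>\<close> unfolding C1_on_def by blast
  obtain \<psi>' where \<psi>': "\<And>x. x \<in> W \<Longrightarrow> (\<psi> has_derivative blinfun_apply (\<psi>' x)) (at x)"
    using \<open>C1_on W \<psi>\<close> unfolding C1_on_def by blast
  have \<psi>\<phi>: "\<psi> (\<phi> x) = x" "\<phi> x \<in> W" if "x \<in> U" for x
    using hom that unfolding homeomorphism_def by auto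
  have \<phi>\<psi>: "\<phi> (\<psi> x) = x" "\<psi> x \<in> U" if "x \<in> W" for x
    using hom that unfolding homeomorphism_def by auto
  have \<psi>M: "\<psi> x \<in> U \<inter> M" if x: "x \<in> W \<inter> S" for x
  proof -
    have "x \<in> \<phi> ` (U \<inter> M)" using x img by simp
    then obtain z where "z \<in> U \<inter> M" "x = \<phi> z" by blast
    then show ?thesis using \<psi>\<phi> by auto
  qed
  \<comment> \<open>The pushforward of \<open>v\<close> under \<phi>, in the coordinates of the
    chart.\<close>
  define F where "F = (\<lambda>x. \<phi>' (\<psi> x) (v (\<psi> x)))"
  have \<psi>_cont: "continuous_on (W \<inter> S) \<psi>"
    using homeomorphism_cont2[OF hom] continuous_on_subset by blast
  have F_cont: "continuous_on (W \<inter> S) F"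
    unfolding F_def
    by (intro continuous_intros continuous_on_compose2[OF \<phi>'_cont \<psi>_cont]
        continuous_on_compose2[OF v \<psi>_cont]) (use \<psi>M in auto)
  \<comment> \<open>A tangent vector is the velocity of a curve in \<open>M\<close>. By continuity
    the curve stays in \<open>U\<close> near time 0, so its image under \<phi> runs in
    \<open>S\<close>, and the velocity of the image lies in \<open>S\<close>.\<close>
  have "\<phi>' z (v z) \<in> S" if z: "z \<in> U \<inter> M" for z
  proof -
    obtain e c where e: "0 < e" "c ` {-e<..<e} \<subseteq> M" "c 0 = z"
      and c: "(c has_vector_derivative v z) (at (0::real))"
      using tan[of z] z unfolding tangent_space_def by blast
    have "isCont c 0" using c has_vector_derivative_continuous by blast
    then have "(c \<longlongrightarrow> z) (nhds 0)"
      unfolding isCont_def using e(3) by (metis tendsto_at_iff_tendsto_nhds)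
    then have "\<forall>\<^sub>F t in nhds 0. c t \<in> U"
      using \<open>open U\<close> z by (auto elim: topological_tendstoD)
    then obtain X where X: "open X" "0 \<in> X" "\<And>t. t \<in> X \<Longrightarrow> c t \<in> U"
      unfolding eventually_nhds by blast
    have "((\<phi> \<circ> c) has_vector_derivative \<phi>' z (v z)) (at 0)"
      using c \<phi>'[of z] z e(3) vector_derivative_diff_chain_within[of c "v z" 0 UNIV \<phi>]
      by (auto intro: has_derivative_at_withinI)
    then show ?thesis
    proof (rule vector_derivative_in_subspace[OF S])
      show "open (X \<inter> {-e<..<e})" "0 \<in> X \<inter> {-e<..<e}" using X e(1) by auto
      show "(\<phi> \<circ> c) ` (X \<inter> {-e<..<e}) \<subseteq> S"
      proof
        fix x assume "x \<in> (\<phi> \<circ> c) ` (X \<inter> {-e<..<e})"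
        then obtain t where "x = \<phi> (c t)" "c t \<in> U \<inter> M" using X e(2) by auto
        then show "x \<in> S" using img by blast
      qed
    qed
  qed
  then have FS: "F ` (W \<inter> S) \<subseteq> S" using \<psi>M by (auto simp: F_def)
  have "\<phi> p \<in> W \<inter> S" using img U \<open>p \<in> M\<close> by blast
  from Peano_subspace[OF W S this F_cont FS]
  obtain T y where T: "0 < T" and y0: "y 0 = \<phi> p" and yW: "y ` {0..T} \<subseteq> W \<inter> S"
    and y: "\<And>t. t \<in> {0..T} \<Longrightarrow> (y has_vector_derivative F (y t)) (at t within {0..T})"
    by blast
  show thesis
  proof
    show "0 < T" by fact
    show "(\<psi> \<circ> y) 0 = p" using y0 \<psi>\<phi> U by simp
    show "(\<psi> \<circ> y) ` {0..<T} \<subseteq> M" using yW \<psi>M by fastforce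
    show "ode_solution v T (\<psi> \<circ> y)"
      unfolding ode_solution_def
    proof
      fix t assume t: "t \<in> {0..<T}"
      then have yt: "y t \<in> W \<inter> S" using yW by auto
      \<comment> \<open>Since \<psi> inverts \<phi> on the open set \<open>U\<close>, the
        derivatives of the two charts compose to the identity, so the inverse chart turns
        \<open>F\<close> back into \<open>v\<close>.\<close>
      have "((\<psi> \<circ> \<phi>) has_derivative \<psi>' (y t) \<circ> \<phi>' (\<psi> (y t))) (at (\<psi> (y t)))"
        using yt \<phi>\<psi> by (intro diff_chain_at \<phi>') (auto intro!: \<psi>')
      then have "((\<lambda>x. x) has_derivative \<psi>' (y t) \<circ> \<phi>' (\<psi> (y t))) (at (\<psi> (y t)))"
        by (rule has_derivative_transform_within_open[OF _ \<open>open U\<close>]) (use \<psi>\<phi> \<phi>\<psi> yt in auto)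
      then have "\<psi>' (y t) \<circ> \<phi>' (\<psi> (y t)) = (\<lambda>x. x)"
        using has_derivative_unique has_derivative_ident by blast
      then have inv: "\<psi>' (y t) (F (y t)) = v (\<psi> (y t))"
        unfolding F_def by (metis comp_apply)
      have "(y has_vector_derivative F (y t)) (at t within {0..<T})"
        using y[of t] t by (auto elim: has_vector_derivative_within_subset)
      then have "((\<psi> \<circ> y) has_vector_derivative \<psi>' (y t) (F (y t))) (at t within {0..<T})"
        using \<psi>' yt by (intro vector_derivative_diff_chain_within) (auto intro: has_derivative_at_withinI)
      then show "((\<psi> \<circ> y) has_vector_derivative v ((\<psi> \<circ> y) t)) (at t within {0..<T})"
        using inv by simp
    qed
  qed
qed

section \<open>Linear algebra of \<open>A\<close>, and conservation along the DAE and the Euler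
  steps\<close>

text \<open>The null space of \<open>A\<close> is the orthogonal complement of the range of the
  transpose; taking complements once more gives the claim. It supplies the \<eta> that represents
  \<gamma>.\<close>

lemma car_eq_range_transpose: "car A = range ((*v) (transpose A))"
proof -
  have "{x. A *v x = 0} = (range ((*v) (transpose A)))\<^sup>\<bottom>"
    using ker_orthogonal_comp_adjoint[of "(*v) A"] by (simp add: adjoint_matrix vimage_def)
  moreover have "subspace (range ((*v) (transpose A)))"
    by (intro linear_subspace_image matrix_vector_mul_linear subspace_UNIV)
  ultimately show ?thesis
    unfolding car_def by (simp add: orthogonal_comp_self)
qed

text \<open>Orthogonality of \<open>f z\<close> to a basis of the complement of the range means
  membership in the double complement, which is the range itself. In this form an Euler step visibly
  lands in \<open>M\<close>.\<close>

lemma uniform_index_1_eq: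
  assumes "uniform_index_1 A f M"
  shows "M = {z. f z \<in> range ((*v) A)}"
proof -
  obtain b where b: "orthonormal_basis (CARD('a) - rank A) b ((range ((*v) A))\<^sup>\<bottom>)"
    and M: "M = {z. \<forall>i < CARD('a) - rank A. b i \<bullet> f z = 0}"
    using assms unfolding uniform_index_1_def by blast
  have "(\<forall>i < CARD('a) - rank A. b i \<bullet> x = 0) \<longleftrightarrow> x \<in> (span (b ` {..<CARD('a) - rank A}))\<^sup>\<bottom>" for x
  proof
    assume "\<forall>i < CARD('a) - rank A. b i \<bullet> x = 0"
    then have "orthogonal x y" if "y \<in> b ` {..<CARD('a) - rank A}" for y
      using that by (auto simp: orthogonal_def inner_commute)
    then show "x \<in> (span (b ` {..<CARD('a) - rank A}))\<^sup>\<bottom>"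
      unfolding orthogonal_comp_def using orthogonal_to_span orthogonal_commute by blast
  next
    assume "x \<in> (span (b ` {..<CARD('a) - rank A}))\<^sup>\<bottom>"
    then show "\<forall>i < CARD('a) - rank A. b i \<bullet> x = 0"
      by (simp add: orthogonal_comp_def orthogonal_def span_base)
  qed
  moreover have "subspace (range ((*v) A))"
    by (intro linear_subspace_image matrix_vector_mul_linear subspace_UNIV)
  ultimately show ?thesis
    using b M by (simp add: orthonormal_basis_def orthogonal_comp_self)
qed

lemma conserved_quantity_regular_dae:
  assumes "regular_dae A f M" "conserved_quantity A f (\<lambda>x. (transpose A *v \<eta>) \<bullet> x)" "p \<in> M"
  shows "\<eta> \<bullet> f p = 0"
proof -
  obtain k v where "C1_submanifold k M" "continuous_on M v" "\<forall>z\<in>M. v z \<in> tangent_space M z"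
    and sol: "\<And>T w. \<lbrakk>T > 0; w differentiable_on {0..<T}; w ` {0..<T} \<subseteq> M\<rbrakk> \<Longrightarrow>
      ode_solution v T w \<longleftrightarrow> dae_solution A f T w"
    using assms(1) unfolding regular_dae_def by auto
  then obtain T w where T: "0 < T" and w: "w 0 = p" "w ` {0..<T} \<subseteq> M" "ode_solution v T w"
    using Peano_submanifold[OF _ assms(3)] by metis
  \<comment> \<open>The equivalence \<open>sol\<close> is stated for differentiable curves
    only.\<close>
  have "w differentiable_on {0..<T}"
    using w(3) unfolding ode_solution_def differentiable_on_def
    by (auto intro: differentiableI_vector)
  then have dae: "dae_solution A f T w" using sol w T by blast
  then obtain z' where z': "(w has_vector_derivative z') (at 0 within {0..<T})" "A *v z' = f p"
    using T w(1) unfolding dae_solution_def by fastforce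
  have "((\<lambda>s. (transpose A *v \<eta>) \<bullet> w s) has_real_derivative 0) (at 0 within {0..<T})"
    using assms(2) dae T unfolding conserved_quantity_def by auto
  then have "((\<lambda>s. (transpose A *v \<eta>) \<bullet> w s) has_vector_derivative 0) (at 0 within {0..<T})"
    by (simp add: has_real_derivative_iff_has_vector_derivative)
  moreover have "((\<lambda>s. (transpose A *v \<eta>) \<bullet> w s) has_vector_derivative (transpose A *v \<eta>) \<bullet> z') (at 0 within {0..<T})"
    using bounded_linear.has_vector_derivative[OF bounded_linear_inner_right z'(1)] .
  \<comment> \<open>0 is a limit point of \<open>{0..<T}\<close>, so the one-sided derivative there
    is unique and the two values found for it agree.\<close>
  moreover have "at 0 within {0..<T} \<noteq> bot"
    using T by (simp add: trivial_limit_within islimpt_Ico)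
  ultimately have "(transpose A *v \<eta>) \<bullet> z' = 0"
    using vector_derivative_unique_within by metis
  then show ?thesis using z'(2) by (simp add: dot_lmul_matrix)
qed

theorem proposition3p2:
  fixes A :: "real ^ 'd ^ 'd"
    and f :: "real ^ 'd \<Rightarrow> real ^ 'd"
    and M :: "(real ^ 'd) set"
    and \<gamma> :: "real ^ 'd"
    and V :: "real ^ 'd \<Rightarrow> real"
    and z :: "nat \<Rightarrow> real ^ 'd"
    and dt :: real
  assumes "regular_dae A f M"
    and "z 0 \<in> M"
    and "dt > 0"
    and "implicit_euler A f dt z"
    and "V = (\<lambda>x. \<gamma> \<bullet> x)"
    and "conserved_quantity A f V"
    and "\<gamma> \<in> car A"
    and "uniform_index_1 A f M"
  shows "\<forall>m. V (z (Suc m)) = V (z m)"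
proof
  fix m
  obtain \<eta> where \<eta>: "\<gamma> = transpose A *v \<eta>"
    using \<open>\<gamma> \<in> car A\<close> by (auto simp: car_eq_range_transpose)
  have step: "A *v ((z (Suc m) - z m) /\<^sub>R dt) = f (z (Suc m))"
    using \<open>implicit_euler A f dt z\<close> by (simp add: implicit_euler_def)
  then have "z (Suc m) \<in> M"
    using uniform_index_1_eq[OF \<open>uniform_index_1 A f M\<close>] by (metis mem_Collect_eq rangeI)
  then have "\<eta> \<bullet> f (z (Suc m)) = 0"
    using conserved_quantity_regular_dae[OF \<open>regular_dae A f M\<close>] assms(5,6) \<eta> by simp
  \<comment> \<open>Moving the transpose across the inner product turns the left side into
    \<open>\<eta> \<bullet> f (z (Suc m))\<close> by the Euler equation.\<close>
  then have "\<gamma> \<bullet> ((z (Suc m) - z m) /\<^sub>R dt) = 0"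
    by (simp only: \<eta> transpose_matrix_vector dot_lmul_matrix step)
  then show "V (z (Suc m)) = V (z m)"
    using \<open>dt > 0\<close> by (simp add: \<open>V = _\<close> inner_diff_right)
qed

end
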